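(* In the secretary matching problem with edge arrival (setting in the context), Algorithm EA has competitive ratio $\frac14$: for every graph $G$ with $m$ edges and nonnegative edge weights satisfying the uniqueness assumption, the matching $\mu$ it returns satisfies $\mathbb{E}[w(\mu)]\ge\frac14\, w(\mu^* )$, where $\mu^*$ is a maximum weight matching of $G$ and the expectation is over the random arrival order and the algorithm's randomness.
   Context: Setting (secretary matching with edge arrival): $G=(V,E)$ is a graph with $m$ edges (with $m$ known) and edge weights $w_e\ge 0$ unknown in advance; $w(\mu)=\sum_{e\in\mu}w_e$. Standing assumption: for every $S\subseteq E$ the maximum weight matching of the graph $G(S)$ with edge set $S$ is unique. The edges arrive in a uniformly random order $e_1,\dots,e_m$; $E_t=\{e_1,\dots,e_t\}$; upon arrival of $e_t$ its weight is revealed and, if both endpoints are unmatched, the algorithm must immediately and irrevocably decide whether to add it to the matching. Define $\alpha_t=0$ if $t\le m/2$ and $\alpha_t=1-2\sum_{i=1}^{t-1}\frac{\alpha_i}{i}$ if $t>m/2$. Algorithm EA: let $A=V$ (available vertices), $\mu=\emptyset$. For $t=\lfloor m/2\rfloor+1,\dots,m$: let $e_t=uv$; let $x_t$ be the probability that both $u,v\in A$ at the start of round $t$, where the probability is over a uniformly random order of the edges of $E_{t-1}$ (with $e_t$ and the set $E_{t-1}$ fixed) and the algorithm's random choices in rounds $1,\dots,t-1$; let $\mu^*_t$ be the maximum weight matching of $G(E_t)$; if $e_t\in\mu^*_t$ and $u,v\in A$, then with probability $\alpha_t/x_t$ add $e_t$ to $\mu$ and remove $u,v$ from $A$. Return $\mu$.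 *)

theory Defs
  imports "HOL-Probability.Probability" "HOL-Combinatorics.Multiset_Permutations"
begin

text \<open>Finite-edge simple graphs: an edge is the two-element set of its endpoints.\<close>

definition simple_graph :: "'v set \<Rightarrow> 'v set set \<Rightarrow> bool" where
  "simple_graph V E \<longleftrightarrow> finite E \<and> (\<forall>e\<in>E. e \<subseteq> V \<and> card e = 2)"

definition matching_in :: "'v set set \<Rightarrow> 'v set set \<Rightarrow> bool" where
  "matching_in S M \<longleftrightarrow> M \<subseteq> S \<and> pairwise disjnt M"

definition max_weight_matching :: "('v set \<Rightarrow> real) \<Rightarrow> 'v set set \<Rightarrow> 'v set set \<Rightarrow> bool" where
  "max_weight_matching w S M \<longleftrightarrow>
     matching_in S M \<and> (\<forall>M'. matching_in S M' \<longrightarrow> sum w M' \<le> sum w M)"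

definition unique_max_matchings :: "('v set \<Rightarrow> real) \<Rightarrow> 'v set set \<Rightarrow> bool" where
  "unique_max_matchings w E \<longleftrightarrow> (\<forall>S\<subseteq>E. \<exists>!M. max_weight_matching w S M)"

definition the_max_matching :: "('v set \<Rightarrow> real) \<Rightarrow> 'v set set \<Rightarrow> 'v set set" where
  "the_max_matching w S = (THE M. max_weight_matching w S M)"

fun alpha :: "nat \<Rightarrow> nat \<Rightarrow> real" where
  "alpha m t = (if real t \<le> real m / 2 then 0
                else 1 - 2 * (\<Sum>i\<in>{1..<t}. alpha m i / real i))"

declare alpha.simps [simp del]

text \<open>
  \<open>EA_rounds V w m t es\<close> is the distribution of the pair (available vertices, current matching)
  after the first \<open>t\<close> rounds when the edges arrive in the order \<open>es\<close>; it depends only on the first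
  \<open>t\<close> entries of \<open>es\<close>. In round \<open>Suc t\<close> the arriving edge is \<open>es ! t\<close>, and \<open>x\<close> is the probability
  that both its endpoints are available at the start of the round, computed for a fresh uniformly
  random order of the set of the \<open>t\<close> earlier edges, hence by the recursive call on that order and
  not by the one on \<open>es\<close>.
  The library's \<open>bernoulli_pmf p\<close> is defined for all real \<open>p\<close> by truncation to the unit interval,
  and a quotient with denominator \<open>0\<close> is \<open>0\<close>. Neither convention matters. If the endpoints are
  available in the current run, then \<open>x > 0\<close>, since the order of that run has positive probability.
  Each endpoint is matched in round \<open>i\<close> with probability at most \<open>alpha m i / i\<close>, so
  \<open>0 \<le> alpha m (Suc t) \<le> x\<close> by the union bound and the definition of \<open>alpha\<close>.
\<close>

primrec EA_rounds ::
  "'v set \<Rightarrow> ('v set \<Rightarrow> real) \<Rightarrow> nat \<Rightarrow> nat \<Rightarrow> 'v set list \<Rightarrow> ('v set \<times> 'v set set) pmf"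
where
  "EA_rounds V w m 0 es = return_pmf (V, {})"
| "EA_rounds V w m (Suc t) es =
     (if Suc t < m div 2 + 1 then EA_rounds V w m t es
      else
        let e = es ! t;
            x = measure_pmf.prob
                  (bind_pmf (pmf_of_set (permutations_of_set (set (take t es))))
                     (\<lambda>es'. EA_rounds V w m t es'))
                  {(A, \<mu>). e \<subseteq> A}
        in bind_pmf (EA_rounds V w m t es) (\<lambda>(A, \<mu>).
             if e \<in> the_max_matching w (set (take (Suc t) es)) \<and> e \<subseteq> A
             then bind_pmf (bernoulli_pmf (alpha m (Suc t) / x)) (\<lambda>b.
                    return_pmf (if b then (A - e, insert e \<mu>) else (A, \<mu>)))
             else return_pmf (A, \<mu>)))"

definition EA :: "'v set \<Rightarrow> 'v set set \<Rightarrow> ('v set \<Rightarrow> real) \<Rightarrow> 'v set set pmf" where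
  "EA V E w =
     bind_pmf (pmf_of_set (permutations_of_set E))
       (\<lambda>es. map_pmf snd (EA_rounds V w (card E) (card E) es))"

end

theory Submission
  imports Defs
begin

text \<open>The last of the first \<open>t\<close> edges is uniform in their set \<open>S\<close>, and the order of the others is
  again uniform, so the state after \<open>t\<close> rounds depends on \<open>S\<close> alone and satisfies a recursion over
  \<open>S - {e}\<close>. Since the acceptance probability is normalised by the availability \<open>x\<close>, each edge of the
  optimum of \<open>S\<close> is accepted with probability \<open>alpha m t / t\<close>. As at most one of these
  edges meets a given vertex, a vertex is unavailable with probability at most the sum of
  \<open>alpha m i / i\<close>, and a union bound yields \<open>alpha m t \<le> x\<close>. Moreover, the expected weight \<open>F S\<close>
  satisfies \<open>t * F S = (\<Sum>e\<in>S. F (S - {e})) + alpha m t * w(opt S)\<close>, which by induction gives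
  \<open>t * F S \<ge> (\<Sum>i\<le>t. alpha m i) * w(opt S)\<close>. For \<open>t = m\<close> the sum of the rates is at least \<open>m / 4\<close>.\<close>

section \<open>Finitely supported mixtures and random permutations\<close>

lemma expectation_bind_finite_support:
  fixes h :: "'b \<Rightarrow> real"
  assumes "finite (set_pmf p)" "\<And>x. x \<in> set_pmf p \<Longrightarrow> finite (set_pmf (f x))"
  shows "measure_pmf.expectation (bind_pmf p f) h =
    measure_pmf.expectation p (\<lambda>x. measure_pmf.expectation (f x) h)"
  using assms by (simp add: pmf_expectation_bind[of "set_pmf p"] integral_measure_pmf[of "set_pmf p"])

text \<open>The library recursion \<open>random_permutation_of_set\<close> exposes the head of the
  list, but the last arrival is needed. Reversal preserves the uniform distribution and moves the
  head to the end.\<close>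

lemma random_permutation_of_set_snoc:
  assumes "finite S" "S \<noteq> {}"
  shows "pmf_of_set (permutations_of_set S) =
    bind_pmf (pmf_of_set S)
      (\<lambda>e. map_pmf (\<lambda>es. es @ [e]) (pmf_of_set (permutations_of_set (S - {e}))))"
proof -
  have rev: "map_pmf rev (pmf_of_set (permutations_of_set T)) = pmf_of_set (permutations_of_set T)"
    if "finite T" for T :: "'a set"
    using that by (subst map_pmf_of_set_inj) auto
  have "pmf_of_set (permutations_of_set S) = map_pmf rev (pmf_of_set (permutations_of_set S))"
    using assms rev by simp
  also have "\<dots> = bind_pmf (pmf_of_set S)
      (\<lambda>e. map_pmf (\<lambda>es. rev es @ [e]) (pmf_of_set (permutations_of_set (S - {e}))))"
    using assms by (subst random_permutation_of_set)
      (simp_all add: map_bind_pmf map_pmf_def bind_assoc_pmf bind_return_pmf)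
  also have "\<dots> = bind_pmf (pmf_of_set S)
      (\<lambda>e. map_pmf (\<lambda>es. es @ [e]) (map_pmf rev (pmf_of_set (permutations_of_set (S - {e})))))"
    by (simp add: pmf.map_comp o_def)
  finally show ?thesis
    using assms by (simp add: rev)
qed

subsection \<open>The acceptance rates\<close>

lemma alpha_eq_0: "t \<le> m div 2 \<Longrightarrow> alpha m t = 0"
  by (subst alpha.simps) simp

lemma alpha_late: "m div 2 < t \<Longrightarrow> alpha m t = 1 - 2 * (\<Sum>i\<in>{1..<t}. alpha m i / real i)"
  by (subst alpha.simps) simp

lemma alpha_first: "alpha m (Suc (m div 2)) = 1"
proof -
  have "(\<Sum>i\<in>{1..<Suc (m div 2)}. alpha m i / real i) = 0"
    by (intro sum.neutral) (simp add: alpha_eq_0)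
  then show ?thesis
    by (simp add: alpha_late)
qed

lemma alpha_Suc:
  assumes "m div 2 < t"
  shows "alpha m (Suc t) = alpha m t * (1 - 2 / real t)"
proof -
  have "{1..<Suc t} = insert t {1..<t}"
    using assms by auto
  then have "(\<Sum>i\<in>{1..<Suc t}. alpha m i / real i) = (\<Sum>i\<in>{1..<t}. alpha m i / real i) + alpha m t / real t"
    by simp
  then have "alpha m (Suc t) = alpha m t - 2 * (alpha m t / real t)"
    using assms by (simp add: alpha_late[of m "Suc t"] alpha_late[of m t])
  then show ?thesis
    by (simp add: algebra_simps)
qed

lemma alpha_nonneg:
  assumes "t \<le> m"
  shows "0 \<le> alpha m t"
proof (cases "t \<le> m div 2")
  case True
  then show ?thesis by (simp add: alpha_eq_0)
next
  case False
  then have "Suc (m div 2) \<le> t" by simp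
  then show ?thesis using assms
  proof (induction t rule: dec_induct)
    case base
    show ?case by (simp add: alpha_first)
  next
    case (step n)
    \<comment> \<open>Here \<open>Suc n <= m\<close> excludes \<open>n = 1\<close>, where the factor
      \<open>1 - 2 / n\<close> would be negative; indeed \<open>alpha 1 2 = -1\<close>.\<close>
    then have "2 \<le> n" by linarith
    then show ?case
      using step by (simp add: alpha_Suc)
  qed
qed

text \<open>The recurrence reads \<open>n * alpha m (Suc n) = (n - 2) * alpha m n\<close>;
  multiplied by \<open>n - 1\<close>, it says that this product is invariant. Product form avoids
  division by zero at \<open>t = 1\<close> and \<open>t = 2\<close>.\<close>

lemma alpha_closed_form:
  assumes "m div 2 < t"
  shows "alpha m t * ((real t - 1) * (real t - 2)) = real (m div 2) * (real (m div 2) - 1)"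
proof -
  have "Suc (m div 2) \<le> t" using assms by simp
  then show ?thesis
  proof (induction t rule: dec_induct)
    case base
    show ?case by (simp add: alpha_first)
  next
    case (step n)
    then have "alpha m (Suc n) * ((real (Suc n) - 1) * (real (Suc n) - 2)) =
        alpha m n * ((real n - 1) * (real n - 2))"
      by (simp add: alpha_Suc field_simps)
    with step.IH show ?case by simp
  qed
qed

text \<open>A telescoping sum: by the recurrence, each rate past \<open>m div 2\<close> is the
  increment of \<open>(2 - t) * alpha m t\<close>.\<close>

lemma sum_alpha:
  assumes "m div 2 < t"
  shows "(\<Sum>i\<in>{1..t}. alpha m i) = real (m div 2) + (2 - real t) * alpha m t"
proof -
  have "Suc (m div 2) \<le> t" using assms by simp
  then show ?thesis
  proof (induction t rule: dec_induct)
    case base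
    have "(\<Sum>i\<in>{1..m div 2}. alpha m i) = 0"
      by (intro sum.neutral) (simp add: alpha_eq_0)
    then show ?case by (simp add: alpha_first)
  next
    case (step n)
    then have "real n * alpha m (Suc n) = (real n - 2) * alpha m n"
      by (simp add: alpha_Suc field_simps)
    with step show ?case
      by (simp add: algebra_simps)
  qed
qed

lemma sum_alpha_ge:
  assumes "0 < m"
  shows "real m / 4 \<le> (\<Sum>i\<in>{1..m}. alpha m i)"
proof -
  define k where "k = m div 2"
  have sum: "(\<Sum>i\<in>{1..m}. alpha m i) = real k + (2 - real m) * alpha m m"
    using assms sum_alpha[of m m] by (simp add: k_def)
  have closed: "alpha m m * ((real m - 1) * (real m - 2)) = real k * (real k - 1)"
    using assms alpha_closed_form[of m m] by (simp add: k_def)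
  have "4 * (real k * (real m - real k)) \<ge> real m * (real m - 1)"
  proof (cases "even m")
    case True
    then have "m = 2 * k" by (simp add: k_def)
    then show ?thesis by (simp add: algebra_simps)
  next
    case False
    then have "m = 2 * k + 1" by (simp add: k_def)
    then show ?thesis by (simp add: algebra_simps)
  qed
  show ?thesis
  proof (cases "m = 1")
    case True
    with sum alpha_first[of 1] show ?thesis by (simp add: k_def)
  next
    case False
    \<comment> \<open>Multiplying by \<open>m - 1\<close> makes the closed form applicable; this is
      why \<open>m = 1\<close> is treated apart.\<close>
    have "(real m - 1) * (\<Sum>i\<in>{1..m}. alpha m i) = real k * (real m - real k)"
      unfolding sum using closed by (simp add: algebra_simps)
    moreover have "(real m - 1) * (real m / 4) \<le> real k * (real m - real k)"
      using \<open>4 * (real k * (real m - real k)) \<ge> real m * (real m - 1)\<close> by (simp add: field_simps)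
    ultimately have "(real m - 1) * (real m / 4) \<le> (real m - 1) * (\<Sum>i\<in>{1..m}. alpha m i)"
      by simp
    then show ?thesis
      using assms False by (subst (asm) mult_le_cancel_left_pos) auto
  qed
qed

subsection \<open>Maximum weight matchings\<close>

lemma matching_in_empty: "matching_in S {}"
  by (simp add: matching_in_def)

lemma the_max_matching:
  assumes "unique_max_matchings w E" "S \<subseteq> E"
  shows "max_weight_matching w S (the_max_matching w S)"
  using assms unfolding unique_max_matchings_def the_max_matching_def by (metis theI')

lemma the_max_matching_eqI:
  assumes "unique_max_matchings w E" "S \<subseteq> E" "max_weight_matching w S M"
  shows "the_max_matching w S = M"
  using assms the_max_matching unfolding unique_max_matchings_def by blast

lemma matching_incident_card_le_1:
  assumes "matching_in S M" "finite S"
  shows "card {e \<in> M. u \<in> e} \<le> 1"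
proof -
  have "finite {e \<in> M. u \<in> e}"
    using assms by (auto simp: matching_in_def intro: finite_subset)
  then show ?thesis
    using assms unfolding matching_in_def pairwise_def disjnt_def
    by (auto simp: card_le_Suc0_iff_eq)
qed

subsection \<open>The algorithm as a recursion over edge sets\<close>

text \<open>The state conditioned on \<open>S\<close> being the set of edges seen so far. The
  quantity \<open>x\<close> in \<open>EA_rounds\<close> is computed from exactly this
  distribution.\<close>

definition EA_after ::
  "'v set \<Rightarrow> ('v set \<Rightarrow> real) \<Rightarrow> nat \<Rightarrow> 'v set set \<Rightarrow> ('v set \<times> 'v set set) pmf"
where
  "EA_after V w m S =
     bind_pmf (pmf_of_set (permutations_of_set S)) (EA_rounds V w m (card S))"

definition availability ::
  "'v set \<Rightarrow> ('v set \<Rightarrow> real) \<Rightarrow> nat \<Rightarrow> 'v set set \<Rightarrow> 'v set \<Rightarrow> real"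
where
  "availability V w m S e = measure_pmf.prob (EA_after V w m S) {(A, \<mu>). e \<subseteq> A}"

definition EA_round ::
  "'v set \<Rightarrow> ('v set \<Rightarrow> real) \<Rightarrow> nat \<Rightarrow> 'v set set \<Rightarrow> 'v set \<Rightarrow>
   'v set \<times> 'v set set \<Rightarrow> ('v set \<times> 'v set set) pmf"
where
  "EA_round V w m S e = (\<lambda>(A, \<mu>).
     if e \<in> the_max_matching w S \<and> e \<subseteq> A
     then bind_pmf (bernoulli_pmf (alpha m (card S) / availability V w m (S - {e}) e)) (\<lambda>b.
            return_pmf (if b then (A - e, insert e \<mu>) else (A, \<mu>)))
     else return_pmf (A, \<mu>))"

lemma bernoulli_pmf_0: "bernoulli_pmf 0 = return_pmf False"
  by (rule pmf_eqI) (simp add: pmf_return indicator_def split: bool.split)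

text \<open>\<open>EA_rounds\<close> skips the early rounds, whereas \<open>EA_round\<close> makes
  no such distinction. The two agree because the acceptance probability is then
  \<open>0\<close>.\<close>

lemma EA_round_early:
  assumes "card S \<le> m div 2"
  shows "EA_round V w m S e = return_pmf"
  using assms by (auto simp: EA_round_def alpha_eq_0 bernoulli_pmf_0 bind_return_pmf)

lemma EA_rounds_append:
  "t \<le> length es \<Longrightarrow> EA_rounds V w m t (es @ es') = EA_rounds V w m t es"
  by (induction t) (simp_all add: nth_append Let_def)

text \<open>In the last round the order of the earlier edges matters only through the current state:
  the optimum and the availability depend on sets alone.\<close>

lemma EA_rounds_snoc:
  assumes "es \<in> permutations_of_set (S - {e})" "finite S" "e \<in> S"
  shows "EA_rounds V w m (card S) (es @ [e]) =
    bind_pmf (EA_rounds V w m (card (S - {e})) es) (EA_round V w m S e)"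
proof -
  have es: "set es = S - {e}" "length es = card (S - {e})"
    using assms by (auto simp: permutations_of_set_def distinct_card[symmetric])
  have card: "card S = Suc (card (S - {e}))"
    using assms by (metis card.remove)
  have "set (es @ [e]) = S"
    using assms es by auto
  show ?thesis
  proof (cases "card S \<le> m div 2")
    case True
    then have "EA_round V w m S e = return_pmf" by (rule EA_round_early)
    with True show ?thesis
      by (simp add: card EA_rounds_append es bind_return_pmf')
  next
    case False
    have "EA_rounds V w m (Suc (card (S - {e}))) (es @ [e]) =
      bind_pmf (EA_rounds V w m (card (S - {e})) es) (EA_round V w m S e)"
      using False card es \<open>set (es @ [e]) = S\<close>
      by (simp add: EA_rounds_append nth_append Let_def EA_round_def availability_def EA_after_def
          cong: if_cong)
    with card show ?thesis by simp
  qed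
qed

lemma EA_after_rec:
  assumes "finite S" "S \<noteq> {}"
  shows "EA_after V w m S =
    bind_pmf (pmf_of_set S) (\<lambda>e. bind_pmf (EA_after V w m (S - {e})) (EA_round V w m S e))"
proof -
  have "EA_after V w m S = bind_pmf (pmf_of_set S) (\<lambda>e.
      bind_pmf (pmf_of_set (permutations_of_set (S - {e})))
        (\<lambda>es. EA_rounds V w m (card S) (es @ [e])))"
    unfolding EA_after_def
    by (subst random_permutation_of_set_snoc[OF assms]) (simp add: bind_assoc_pmf bind_map_pmf)
  also have "\<dots> = bind_pmf (pmf_of_set S) (\<lambda>e.
      bind_pmf (pmf_of_set (permutations_of_set (S - {e})))
        (\<lambda>es. bind_pmf (EA_rounds V w m (card (S - {e})) es) (EA_round V w m S e)))"
    using assms by (intro bind_pmf_cong refl) (auto simp: EA_rounds_snoc)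
  finally show ?thesis
    by (simp add: EA_after_def bind_assoc_pmf)
qed

lemma EA_after_empty: "EA_after V w m {} = return_pmf (V, {})"
  by (simp add: EA_after_def pmf_of_set_singleton bind_return_pmf)

lemma finite_set_pmf_EA_round: "finite (set_pmf (EA_round V w m S e s))"
  by (cases s) (auto simp: EA_round_def)

lemma finite_set_pmf_EA_after:
  assumes "finite S"
  shows "finite (set_pmf (EA_after V w m S))"
  using assms
proof (induction S rule: finite_remove_induct)
  case empty
  show ?case by (simp add: EA_after_empty)
next
  case (remove S)
  then show ?case
    by (subst EA_after_rec) (auto simp: finite_set_pmf_EA_round)
qed

text \<open>Ensures that an arriving edge is not yet in the matching, so accepting it raises the
  weight by exactly \<open>w e\<close>.\<close>

lemma set_pmf_EA_after_subset:
  assumes "finite S" "s \<in> set_pmf (EA_after V w m S)"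
  shows "snd s \<subseteq> S"
  using assms
proof (induction S arbitrary: s rule: finite_remove_induct)
  case empty
  then show ?case by (simp add: EA_after_empty)
next
  case (remove S)
  from remove.prems remove.hyps obtain e s' where
    e: "e \<in> S" "s' \<in> set_pmf (EA_after V w m (S - {e}))" "s \<in> set_pmf (EA_round V w m S e s')"
    by (subst (asm) EA_after_rec) auto
  then have "snd s \<subseteq> insert e (snd s')"
    by (auto simp: EA_round_def split: if_splits prod.splits)
  with remove.IH[OF e(1,2)] e(1) show ?case by blast
qed

lemma expectation_EA_round:
  fixes h :: "'v set \<times> 'v set set \<Rightarrow> real"
  assumes "0 \<le> alpha m (card S)" "alpha m (card S) \<le> availability V w m (S - {e}) e"
  shows "measure_pmf.expectation (EA_round V w m S e (A, \<mu>)) h = h (A, \<mu>) +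
    (if e \<in> the_max_matching w S \<and> e \<subseteq> A
     then alpha m (card S) / availability V w m (S - {e}) e * (h (A - e, insert e \<mu>) - h (A, \<mu>))
     else 0)"
proof -
  define p where "p = alpha m (card S) / availability V w m (S - {e}) e"
  \<comment> \<open>Hence \<open>bernoulli_pmf\<close> does not truncate; for zero availability,
    \<open>p = 0\<close>.\<close>
  have p: "0 \<le> p" "p \<le> 1"
    using assms by (auto simp: p_def divide_simps)
  have "measure_pmf.expectation (bind_pmf (bernoulli_pmf p)
      (\<lambda>b. return_pmf (if b then (A - e, insert e \<mu>) else (A, \<mu>)))) h =
      h (A, \<mu>) + p * (h (A - e, insert e \<mu>) - h (A, \<mu>))"
    using p by (subst expectation_bind_finite_support) (auto simp: algebra_simps)
  then show ?thesis
    by (auto simp: EA_round_def p_def[symmetric])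
qed

text \<open>The factor \<open>1 / x\<close> in the acceptance probability cancels against the probability \<open>x\<close> that
  both endpoints are available, so an edge of the current optimum contributes its increment with
  weight exactly \<open>alpha\<close>.\<close>

lemma expectation_EA_after_additive:
  fixes h :: "'v set \<times> 'v set set \<Rightarrow> real"
  assumes S: "finite S" "S \<noteq> {}" "the_max_matching w S \<subseteq> S"
    and nonneg: "0 \<le> alpha m (card S)"
    and le: "\<And>e. e \<in> S \<Longrightarrow> alpha m (card S) \<le> availability V w m (S - {e}) e"
    and incr: "\<And>e A \<mu>. \<lbrakk>e \<in> the_max_matching w S; e \<subseteq> A; \<mu> \<subseteq> S - {e}\<rbrakk> \<Longrightarrow>
      h (A - e, insert e \<mu>) - h (A, \<mu>) = c e"
  shows "real (card S) * measure_pmf.expectation (EA_after V w m S) h =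
    (\<Sum>e\<in>S. measure_pmf.expectation (EA_after V w m (S - {e})) h) +
    alpha m (card S) * sum c (the_max_matching w S)"
proof -
  let ?M = "the_max_matching w S"
  have step: "measure_pmf.expectation
      (bind_pmf (EA_after V w m (S - {e})) (EA_round V w m S e)) h =
      measure_pmf.expectation (EA_after V w m (S - {e})) h +
      (if e \<in> ?M then alpha m (card S) * c e else 0)" if e: "e \<in> S" for e
  proof -
    define x where "x = availability V w m (S - {e}) e"
    let ?P = "EA_after V w m (S - {e})"
    let ?d = "if e \<in> ?M then alpha m (card S) / x * c e else 0"
    have fin: "finite (set_pmf ?P)"
      using S by (simp add: finite_set_pmf_EA_after)
    have "measure_pmf.expectation (bind_pmf ?P (EA_round V w m S e)) h =
        measure_pmf.expectation ?P (\<lambda>s. measure_pmf.expectation (EA_round V w m S e s) h)"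
      by (rule expectation_bind_finite_support) (auto simp: fin finite_set_pmf_EA_round)
    also have "\<dots> = measure_pmf.expectation ?P
        (\<lambda>s. h s + ?d * indicator {(A, \<mu>). e \<subseteq> A} s)"
    proof (rule integral_cong_AE)
      show "AE s in ?P. measure_pmf.expectation (EA_round V w m S e s) h =
          h s + ?d * indicator {(A, \<mu>). e \<subseteq> A} s"
        unfolding AE_measure_pmf_iff
      proof safe
        fix A \<mu> assume s: "(A, \<mu>) \<in> set_pmf ?P"
        have "\<mu> \<subseteq> S - {e}"
          using set_pmf_EA_after_subset[OF _ s] S by simp
        then show "measure_pmf.expectation (EA_round V w m S e (A, \<mu>)) h =
            h (A, \<mu>) + ?d * indicator {(A, \<mu>). e \<subseteq> A} (A, \<mu>)"
          using expectation_EA_round[OF nonneg le[OF e], of A \<mu> h] incr[of e A \<mu>]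
          by (auto simp: x_def[symmetric])
      qed
    qed simp_all
    also have "\<dots> = measure_pmf.expectation ?P h + ?d * x"
      by (subst Bochner_Integration.integral_add)
        (auto simp: x_def availability_def intro!: integrable_measure_pmf_finite fin)
    \<comment> \<open>If \<open>x = 0\<close>, then \<open>alpha m (card S) = 0\<close> by the two
      bounds, so the cancellation still holds.\<close>
    also have "?d * x = (if e \<in> ?M then alpha m (card S) * c e else 0)"
      using nonneg le[OF e] by (auto simp: x_def[symmetric])
    finally show ?thesis .
  qed
  have "measure_pmf.expectation (EA_after V w m S) h =
      (\<Sum>e\<in>S. measure_pmf.expectation
        (bind_pmf (EA_after V w m (S - {e})) (EA_round V w m S e)) h /\<^sub>R real (card S))"
    unfolding EA_after_rec[OF S(1,2)] using S
    by (subst pmf_expectation_bind_pmf_of_set)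
      (auto simp: finite_set_pmf_EA_after finite_set_pmf_EA_round)
  then have "real (card S) * measure_pmf.expectation (EA_after V w m S) h =
      (\<Sum>e\<in>S. measure_pmf.expectation
        (bind_pmf (EA_after V w m (S - {e})) (EA_round V w m S e)) h)"
    using S by (simp add: sum_distrib_left[symmetric])
  also have "\<dots> = (\<Sum>e\<in>S. measure_pmf.expectation (EA_after V w m (S - {e})) h) +
      (\<Sum>e\<in>S. if e \<in> ?M then alpha m (card S) * c e else 0)"
    by (simp add: step sum.distrib)
  also have "(\<Sum>e\<in>S. if e \<in> ?M then alpha m (card S) * c e else 0) =
      alpha m (card S) * sum c ?M"
    using S by (simp add: sum.If_cases sum_distrib_left Int_absorb1)
  finally show ?thesis .
qed

subsection \<open>The endpoints of an edge are available often enough\<close>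

text \<open>The factor 2 in \<open>alpha\<close> pays for the union bound over the two endpoints.
  The bound on unavailability is a hypothesis so that the induction proving it can apply this lemma
  to smaller sets.\<close>

lemma alpha_le_availability:
  assumes unavailable: "\<And>u. u \<in> V \<Longrightarrow>
      measure_pmf.prob (EA_after V w m S) {(A, \<mu>). u \<notin> A} \<le> (\<Sum>i\<in>{1..card S}. alpha m i / real i)"
    and e: "e \<subseteq> V" "card e = 2"
  shows "alpha m (Suc (card S)) \<le> availability V w m S e"
proof (cases "Suc (card S) \<le> m div 2")
  case True
  then show ?thesis by (simp add: alpha_eq_0 availability_def)
next
  case False
  let ?prob = "measure_pmf.prob (EA_after V w m S)"
  obtain u v where uv: "e = {u, v}"
    using e(2) by (auto simp: card_2_iff)
  have "1 - availability V w m S e = ?prob (- {(A, \<mu>). e \<subseteq> A})"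
    by (simp add: availability_def measure_pmf.prob_compl[simplified] Compl_eq_Diff_UNIV)
  also have "- {(A, \<mu>). e \<subseteq> A} = {(A, \<mu>). u \<notin> A} \<union> {(A, \<mu> :: 'a set set). v \<notin> A}"
    by (auto simp: uv)
  also have "?prob \<dots> \<le> ?prob {(A, \<mu>). u \<notin> A} + ?prob {(A, \<mu>). v \<notin> A}"
    by (rule measure_Un_le) auto
  also have "\<dots> \<le> 2 * (\<Sum>i\<in>{1..card S}. alpha m i / real i)"
    using unavailable[of u] unavailable[of v] e by (simp add: uv)
  finally show ?thesis
    using False by (simp add: alpha_late atLeastLessThanSuc_atLeastAtMost)
qed

context
  fixes V :: "'v set" and E :: "'v set set" and w :: "'v set \<Rightarrow> real"
  assumes graph: "simple_graph V E" and unique: "unique_max_matchings w E"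
begin

lemma max_matching_subset:
  assumes "S \<subseteq> E"
  shows "finite S" "max_weight_matching w S (the_max_matching w S)" "the_max_matching w S \<subseteq> S"
    "matching_in S (the_max_matching w S)"
  using assms graph the_max_matching[OF unique assms]
  by (auto simp: simple_graph_def max_weight_matching_def matching_in_def intro: finite_subset)

text \<open>The induction is intertwined with \<open>alpha_le_availability\<close>: the bounds for
  \<open>S - {e}\<close> make the acceptance probability in the round of \<open>S\<close>
  legitimate, and that round adds at most \<open>alpha / card S\<close>.\<close>

lemma prob_unavailable_le:
  assumes "S \<subseteq> E" "u \<in> V"
  shows "measure_pmf.prob (EA_after V w (card E) S) {(A, \<mu>). u \<notin> A} \<le>
    (\<Sum>i\<in>{1..card S}. alpha (card E) i / real i)"
  using max_matching_subset(1)[OF assms(1)] assms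
proof (induction S arbitrary: u rule: finite_remove_induct)
  case empty
  then show ?case by (simp add: EA_after_empty)
next
  case (remove S)
  let ?m = "card E" and ?M = "the_max_matching w S"
  let ?p = "\<lambda>S. measure_pmf.prob (EA_after V w ?m S) {(A, \<mu>). u \<notin> A}"
  let ?h = "indicator {(A, \<mu>). u \<notin> A} :: 'v set \<times> 'v set set \<Rightarrow> real"
  define s where "s = (\<Sum>i\<in>{1..card S - 1}. alpha ?m i / real i)"
  have M: "?M \<subseteq> S" "matching_in S ?M"
    using max_matching_subset remove.prems by auto
  have nonneg: "0 \<le> alpha ?m (card S)"
    using remove.prems graph by (intro alpha_nonneg card_mono) (auto simp: simple_graph_def)
  have "0 < card S"
    using remove.hyps by (simp add: card_gt_0_iff)
  have card: "Suc (card (S - {e})) = card S" if "e \<in> S" for e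
    using that remove.hyps by (metis card.remove)
  have le: "alpha ?m (card S) \<le> availability V w ?m (S - {e}) e" if e: "e \<in> S" for e
  proof -
    have "alpha ?m (Suc (card (S - {e}))) \<le> availability V w ?m (S - {e}) e"
      using remove.IH[OF e] remove.prems e graph
      by (intro alpha_le_availability) (auto simp: simple_graph_def)
    with card[OF e] show ?thesis by simp
  qed
  have "real (card S) * measure_pmf.expectation (EA_after V w ?m S) ?h =
      (\<Sum>e\<in>S. measure_pmf.expectation (EA_after V w ?m (S - {e})) ?h) +
      alpha ?m (card S) * (\<Sum>e\<in>?M. if u \<in> e then 1 else 0)"
    using remove.hyps M nonneg le
    by (intro expectation_EA_after_additive) (auto simp: indicator_def)
  then have "real (card S) * ?p S = (\<Sum>e\<in>S. ?p (S - {e})) +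
      alpha ?m (card S) * real (card {e \<in> ?M. u \<in> e})"
    using M remove.hyps finite_subset[of ?M S] by (simp add: sum.If_cases Int_def)
  also have "\<dots> \<le> (\<Sum>e\<in>S. s) + alpha ?m (card S) * 1"
  proof (intro add_mono sum_mono mult_left_mono nonneg)
    fix e assume e: "e \<in> S"
    show "?p (S - {e}) \<le> s"
      using remove.IH[OF e, of u] remove.prems remove.hyps e by (auto simp: s_def)
  qed (use matching_incident_card_le_1[OF M(2)] remove.hyps in auto)
  also have "\<dots> = real (card S) * (s + alpha ?m (card S) / real (card S))"
    using \<open>0 < card S\<close> by (simp add: algebra_simps)
  finally have "?p S \<le> s + alpha ?m (card S) / real (card S)"
    using \<open>0 < card S\<close> by (simp only: mult_le_cancel_left_pos of_nat_0_less_iff)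
  also have "\<dots> = (\<Sum>i\<in>{1..card S}. alpha ?m i / real i)"
    using \<open>0 < card S\<close> by (cases "card S") (auto simp: s_def)
  finally show ?case .
qed

lemma alpha_le_availability_remove:
  assumes "S \<subseteq> E" "e \<in> S"
  shows "alpha (card E) (card S) \<le> availability V w (card E) (S - {e}) e"
proof -
  have "alpha (card E) (Suc (card (S - {e}))) \<le> availability V w (card E) (S - {e}) e"
    using assms graph by (intro alpha_le_availability prob_unavailable_le) (auto simp: simple_graph_def)
  moreover have "Suc (card (S - {e})) = card S"
    using assms max_matching_subset(1) by (metis card.remove)
  ultimately show ?thesis by simp
qed

subsection \<open>Expected weight of the returned matching\<close>

text \<open>Deleting a uniformly random edge from \<open>S\<close> destroys each edge of the optimum with probability
  \<open>1 / card S\<close>.\<close>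

lemma sum_max_matching_remove_ge:
  assumes "S \<subseteq> E"
  shows "(real (card S) - 1) * sum w (the_max_matching w S) \<le>
    (\<Sum>e\<in>S. sum w (the_max_matching w (S - {e})))"
proof -
  let ?M = "the_max_matching w S"
  note M = max_matching_subset[OF assms]
  have "finite ?M" using M finite_subset by blast
  have "(\<Sum>e\<in>S. if e \<in> ?M then w e else 0) = sum w ?M"
    using M by (simp add: sum.If_cases Int_absorb1)
  then have "(real (card S) - 1) * sum w ?M = (\<Sum>e\<in>S. sum w ?M - (if e \<in> ?M then w e else 0))"
    by (simp add: sum_subtractf algebra_simps)
  also have "\<dots> = (\<Sum>e\<in>S. sum w (?M - {e}))"
    using \<open>finite ?M\<close> by (intro sum.cong) (auto simp: sum_diff1)
  also have "\<dots> \<le> (\<Sum>e\<in>S. sum w (the_max_matching w (S - {e})))"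
  proof (rule sum_mono)
    fix e
    have "matching_in (S - {e}) (?M - {e})"
      using M(4) by (auto simp: matching_in_def intro: pairwise_subset)
    moreover have "max_weight_matching w (S - {e}) (the_max_matching w (S - {e}))"
      using assms by (intro max_matching_subset) auto
    ultimately show "sum w (?M - {e}) \<le> sum w (the_max_matching w (S - {e}))"
      by (simp add: max_weight_matching_def)
  qed
  finally show ?thesis .
qed

text \<open>All sets \<open>S - {e}\<close> have the same size, hence the same rate sum
  \<open>s\<close> in the induction hypothesis. Its factor \<open>card S - 1\<close> cancels the one
  from \<open>sum_max_matching_remove_ge\<close>.\<close>

lemma expectation_EA_after_ge:
  assumes "S \<subseteq> E"
  shows "(\<Sum>i\<in>{1..card S}. alpha (card E) i) * sum w (the_max_matching w S) \<le>
    real (card S) * measure_pmf.expectation (EA_after V w (card E) S) (\<lambda>(A, \<mu>). sum w \<mu>)"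
  using max_matching_subset(1)[OF assms] assms
proof (induction S rule: finite_remove_induct)
  case empty
  then show ?case by simp
next
  case (remove S)
  let ?m = "card E" and ?W = "\<lambda>S. sum w (the_max_matching w S)"
  let ?F = "\<lambda>S. measure_pmf.expectation (EA_after V w ?m S) (\<lambda>(A, \<mu>). sum w \<mu>)"
  define s where "s = (\<Sum>i\<in>{1..card S - 1}. alpha ?m i)"
  have "card S \<le> ?m"
    using remove.prems graph by (intro card_mono) (auto simp: simple_graph_def)
  have "0 \<le> s"
    unfolding s_def using \<open>card S \<le> ?m\<close> by (intro sum_nonneg alpha_nonneg) auto
  have "0 < card S"
    using remove.hyps by (simp add: card_gt_0_iff)
  have "finite \<mu>" "e \<notin> \<mu>" if "\<mu> \<subseteq> S - {e}" for \<mu> e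
    using that remove.hyps by (auto intro: finite_subset)
  then have rec: "real (card S) * ?F S = (\<Sum>e\<in>S. ?F (S - {e})) + alpha ?m (card S) * ?W S"
    using remove.hyps remove.prems max_matching_subset[of S] \<open>card S \<le> ?m\<close>
    by (intro expectation_EA_after_additive)
      (auto simp: alpha_nonneg alpha_le_availability_remove)
  have "(real (card S) - 1) * (s * ?W S) \<le> s * (\<Sum>e\<in>S. ?W (S - {e}))"
    using mult_left_mono[OF sum_max_matching_remove_ge[OF remove.prems] \<open>0 \<le> s\<close>]
    by (simp add: algebra_simps)
  also have "\<dots> = (\<Sum>e\<in>S. s * ?W (S - {e}))"
    by (simp add: sum_distrib_left)
  also have "\<dots> \<le> (\<Sum>e\<in>S. (real (card S) - 1) * ?F (S - {e}))"
  proof (rule sum_mono)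
    fix e assume e: "e \<in> S"
    have "real (card (S - {e})) = real (card S) - 1"
      using e remove.hyps \<open>0 < card S\<close> by simp
    with remove.IH[OF e] remove.prems remove.hyps e
    show "s * ?W (S - {e}) \<le> (real (card S) - 1) * ?F (S - {e})"
      by (auto simp: s_def)
  qed
  also have "\<dots> = (real (card S) - 1) * (\<Sum>e\<in>S. ?F (S - {e}))"
    by (simp add: sum_distrib_left)
  finally have *: "(real (card S) - 1) * (s * ?W S) \<le> (real (card S) - 1) * (\<Sum>e\<in>S. ?F (S - {e}))" .
  have "s * ?W S \<le> (\<Sum>e\<in>S. ?F (S - {e}))"
  \<comment> \<open>For a singleton the common factor is 0 and cannot be cancelled, but then
    \<open>s\<close> is an empty sum.\<close>
  proof (cases "card S = 1")
    case True
    then obtain e where "S = {e}" by (auto simp: card_1_singleton_iff)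
    then show ?thesis by (simp add: s_def EA_after_empty)
  next
    case False
    with \<open>0 < card S\<close> have "0 < real (card S) - 1" by simp
    with * show ?thesis by (simp only: mult_le_cancel_left_pos)
  qed
  then have "(s + alpha ?m (card S)) * ?W S \<le> real (card S) * ?F S"
    by (simp add: rec algebra_simps)
  also have "s + alpha ?m (card S) = (\<Sum>i\<in>{1..card S}. alpha ?m i)"
    using \<open>0 < card S\<close> by (cases "card S") (auto simp: s_def)
  finally show ?case .
qed

end

theorem theorem12:
  fixes V :: "'v set" and E :: "'v set set" and w :: "'v set \<Rightarrow> real"
  assumes "simple_graph V E"
    and "\<And>e. e \<in> E \<Longrightarrow> 0 \<le> w e"
    and "unique_max_matchings w E"
    and "max_weight_matching w E \<mu>opt"
  shows "measure_pmf.expectation (EA V E w) (\<lambda>\<mu>. sum w \<mu>) \<ge> 1 / 4 * sum w \<mu>opt"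
proof -
  let ?F = "measure_pmf.expectation (EA_after V w (card E) E) (\<lambda>(A, \<mu>). sum w \<mu>)"
  have opt: "the_max_matching w E = \<mu>opt"
    using assms by (intro the_max_matching_eqI) auto
  have "EA V E w = map_pmf snd (EA_after V w (card E) E)"
    by (simp add: EA_def EA_after_def map_bind_pmf)
  then have EA: "measure_pmf.expectation (EA V E w) (\<lambda>\<mu>. sum w \<mu>) = ?F"
    by (simp add: case_prod_unfold)
  \<comment> \<open>The optimum is nonnegative by comparison with the empty matching.\<close>
  have "sum w {} \<le> sum w \<mu>opt"
    using assms(4) matching_in_empty unfolding max_weight_matching_def by blast
  then have nonneg: "0 \<le> sum w \<mu>opt" by simp
  show ?thesis
  proof (cases "E = {}")
    case True
    then have "\<mu>opt = {}"
      using assms(4) by (simp add: max_weight_matching_def matching_in_def)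
    with True EA show ?thesis by (simp add: EA_after_empty)
  next
    case False
    then have "0 < card E"
      using assms(1) by (simp add: simple_graph_def card_gt_0_iff)
    have "real (card E) * (1 / 4 * sum w \<mu>opt) \<le> (\<Sum>i\<in>{1..card E}. alpha (card E) i) * sum w \<mu>opt"
      using mult_right_mono[OF sum_alpha_ge[OF \<open>0 < card E\<close>] nonneg] by simp
    also have "\<dots> \<le> real (card E) * ?F"
      using expectation_EA_after_ge[OF assms(1,3) subset_refl] by (simp add: opt)
    finally show ?thesis
      using \<open>0 < card E\<close> EA by (simp only: mult_le_cancel_left_pos of_nat_0_less_iff)
  qed
qed

end
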